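(* Let $X$ be a real or complex Banach space. (i) If $X$ is sluacs, then $X$ is LUNSQ. (ii) If $X$ is acs, then $X$ is NSQ.
   Context: $S_X$ denotes the unit sphere of $X$ and $X^*$ its dual. $X$ is strongly locally uniformly alternatively convex or smooth (sluacs) if for every $x \in S_X$ and all sequences $(x_n) \subset S_X$, $(x_n^* ) \subset S_{X^*}$, the conditions $\|x_n + x\| \to 2$ and $x_n^*(x_n) \to 1$ imply $x_n^*(x) \to 1$. $X$ is alternatively convex or smooth (acs) if for all $x,y \in S_X$ and $x^* \in S_{X^*}$, the conditions $\|x+y\| = 2$ and $x^*(x)=1$ imply $x^*(y)=1$. $X$ is locally uniformly nonsquare (LUNSQ) if for every $x \in S_X$ there exists $\delta>0$ such that $\min\{\|x+y\|,\|x-y\|\} \leq 2-\delta$ for every $y \in S_X$. $X$ is nonsquare (NSQ) if $\min\{\|x+y\|,\|x-y\|\}<2$ for all $x,y\in S_X$. *)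

theory Defs
  imports "HOL-Analysis.Analysis"
begin

text \<open>
  The scalar multiplication \<open>smul\<close> is an explicit parameter, because the library has a class only
  for real Banach spaces. A complex Banach space is a type of class \<open>banach\<close> together with a
  complex scalar multiplication that extends the real one and makes the norm absolutely homogeneous;
  completeness depends only on the norm and is provided by the class.
\<close>

locale normed_space_over = vector_space smul
  for smul :: "'k::real_normed_field \<Rightarrow> 'a::real_normed_vector \<Rightarrow> 'a" +
  assumes smul_of_real: "smul (of_real r) x = r *\<^sub>R x"
    and norm_smul: "norm (smul c x) = norm c * norm x"

lemma normed_space_over_scaleR:
  "normed_space_over ((*\<^sub>R) :: real \<Rightarrow> 'a::real_normed_vector \<Rightarrow> 'a)"
  by unfold_locales (simp_all add: scaleR_add_right scaleR_add_left)

text \<open>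
  The functionals of norm 1 that are linear over the scalar field, not just over the reals.
\<close>

definition dual_sphere ::
    "('k::real_normed_field \<Rightarrow> 'a::real_normed_vector \<Rightarrow> 'a) \<Rightarrow> ('a \<Rightarrow> 'k) set" where
  "dual_sphere smul =
     {f. Vector_Spaces.linear smul (*) f \<and> bounded_linear f \<and> onorm f = 1}"

lemma dual_sphere_scaleR:
  "dual_sphere ((*\<^sub>R) :: real \<Rightarrow> 'a::real_normed_vector \<Rightarrow> 'a) = blinfun_apply ` sphere 0 1"
proof -
  have "Vector_Spaces.linear (*\<^sub>R) (*) f" if "bounded_linear f" for f :: "'a \<Rightarrow> real"
    using bounded_linear.linear[OF that] unfolding linear_def real_scaleR_def[abs_def] .
  then have "dual_sphere (*\<^sub>R) = {f :: 'a \<Rightarrow> real. bounded_linear f \<and> onorm f = 1}"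
    by (auto simp: dual_sphere_def)
  also have "\<dots> = blinfun_apply ` sphere 0 1"
  proof (intro equalityI subsetI)
    fix f :: "'a \<Rightarrow> real"
    assume "f \<in> {f. bounded_linear f \<and> onorm f = 1}"
    then show "f \<in> blinfun_apply ` sphere 0 1"
      by (intro image_eqI[of _ _ "Blinfun f"])
        (simp_all add: bounded_linear_Blinfun_apply norm_blinfun.rep_eq)
  qed (auto simp: norm_blinfun.rep_eq blinfun.bounded_linear_right)
  finally show ?thesis .
qed

definition sluacs ::
    "('k::real_normed_field \<Rightarrow> 'a::real_normed_vector \<Rightarrow> 'a) \<Rightarrow> bool" where
  "sluacs smul \<longleftrightarrow>
     (\<forall>x \<in> sphere 0 1. \<forall>(xs :: nat \<Rightarrow> 'a) (fs :: nat \<Rightarrow> 'a \<Rightarrow> 'k).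
        (\<forall>n. xs n \<in> sphere 0 1) \<longrightarrow> (\<forall>n. fs n \<in> dual_sphere smul) \<longrightarrow>
        (\<lambda>n. norm (xs n + x)) \<longlonglongrightarrow> 2 \<longrightarrow> (\<lambda>n. fs n (xs n)) \<longlonglongrightarrow> 1 \<longrightarrow>
        (\<lambda>n. fs n x) \<longlonglongrightarrow> 1)"

definition acs ::
    "('k::real_normed_field \<Rightarrow> 'a::real_normed_vector \<Rightarrow> 'a) \<Rightarrow> bool" where
  "acs smul \<longleftrightarrow>
     (\<forall>x \<in> sphere 0 1. \<forall>y \<in> sphere 0 1. \<forall>f \<in> dual_sphere smul.
        norm (x + y) = 2 \<longrightarrow> f x = 1 \<longrightarrow> f y = 1)"

definition lunsq :: "'a::real_normed_vector itself \<Rightarrow> bool" where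
  "lunsq _ \<longleftrightarrow>
     (\<forall>x \<in> sphere (0::'a) 1. \<exists>\<delta>>0. \<forall>y \<in> sphere 0 1.
        min (norm (x + y)) (norm (x - y)) \<le> 2 - \<delta>)"

definition nsq :: "'a::real_normed_vector itself \<Rightarrow> bool" where
  "nsq _ \<longleftrightarrow>
     (\<forall>x \<in> sphere (0::'a) 1. \<forall>y \<in> sphere 0 1. min (norm (x + y)) (norm (x - y)) < 2)"

end

theory Submission
  imports Defs
begin

text \<open>
  Let \<open>x\<close>, \<open>y\<close> be unit vectors with both \<open>x + y\<close> and \<open>x - y\<close> of norm (almost) 2, and let \<open>f\<close> be a
  functional of norm 1 attaining its norm at \<open>x + y\<close>. Then \<open>f x\<close> and \<open>f y\<close> are both (almost) 1,
  while the convexity property, applied to the pair \<open>y\<close>, \<open>- x\<close>, forces \<open>f (- x)\<close> to be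
  (almost) 1 as well.

  The norming functional comes from the Hahn--Banach theorem in the following form: by Zorn's lemma
  there is a minimal sublinear functional below a given one, and a minimal sublinear functional
  is linear.
\<close>

section \<open>Hahn--Banach via minimal sublinear functionals\<close>

definition sublinear :: "('a::real_vector \<Rightarrow> real) \<Rightarrow> bool" where
  "sublinear p \<longleftrightarrow> (\<forall>x y. p (x + y) \<le> p x + p y) \<and> (\<forall>r\<ge>0. \<forall>x. p (r *\<^sub>R x) = r * p x)"

lemma sublinear_add: "sublinear p \<Longrightarrow> p (x + y) \<le> p x + p y"
  and sublinear_scale: "sublinear p \<Longrightarrow> 0 \<le> r \<Longrightarrow> p (r *\<^sub>R x) = r * p x"
  by (auto simp: sublinear_def)

lemma sublinear_0: "sublinear p \<Longrightarrow> p 0 = 0"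
  using sublinear_scale[of p 0 0] by simp

lemma sublinear_ge_minus: "sublinear p \<Longrightarrow> - p (- x) \<le> p x"
  using sublinear_add[of p x "- x"] sublinear_0[of p] by simp

lemma sublinearI:
  assumes add: "\<And>x y. p (x + y) \<le> p x + p y"
    and scale: "\<And>r x. 0 < r \<Longrightarrow> p (r *\<^sub>R x) \<le> r * p x"
    and zero: "p 0 = 0"
  shows "sublinear p"
proof -
  have "p (r *\<^sub>R x) = r * p x" if "0 \<le> r" for r x
  proof (cases "r = 0")
    case False
    with that have "0 < r" by simp
    \<comment> \<open>The reverse inequality is the assumed one, used with factor
      \<open>inverse r\<close> at the vector \<open>r *\<^sub>R x\<close>.\<close>
    then have "r * p x \<le> p (r *\<^sub>R x)"
      using scale[of "inverse r" "r *\<^sub>R x"] by (simp add: field_simps)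
    with scale[OF \<open>0 < r\<close>, of x] show ?thesis by simp
  qed (simp add: zero)
  with add show ?thesis by (simp add: sublinear_def)
qed

text \<open>The hypotheses \<open>add\<close> and \<open>scale\<close> are directedness conditions:
  whatever indices occur on the right, one index does at least as well on the left. They fit both
  families used below, the shifts of one functional and a chain of functionals.\<close>

lemma sublinear_INF:
  fixes g :: "'i \<Rightarrow> 'a::real_vector \<Rightarrow> real"
  assumes bdd: "\<And>x. bdd_below ((\<lambda>i. g i x) ` I)"
    and add: "\<And>i j x y. i \<in> I \<Longrightarrow> j \<in> I \<Longrightarrow> \<exists>k\<in>I. g k (x + y) \<le> g i x + g j y"
    and scale: "\<And>r i x. 0 < r \<Longrightarrow> i \<in> I \<Longrightarrow> \<exists>k\<in>I. g k (r *\<^sub>R x) \<le> r * g i x"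
    and zero: "\<And>i. i \<in> I \<Longrightarrow> g i 0 = 0"
    and "I \<noteq> {}"
  shows "sublinear (\<lambda>x. INF i\<in>I. g i x)"
proof (rule sublinearI)
  fix x y
  \<comment> \<open>The infima on the right are reached one at a time: with \<open>g j y\<close>
    moved to the left the bound is free of \<open>i\<close>, and afterwards \<open>j\<close> is
    treated in the same way.\<close>
  have "(INF i\<in>I. g i (x + y)) - g j y \<le> g i x" if "i \<in> I" "j \<in> I" for i j
    using add[OF that, of x y] cINF_lower[OF bdd, of _ "x + y"] by fastforce
  then have "(INF i\<in>I. g i (x + y)) - g j y \<le> (INF i\<in>I. g i x)" if "j \<in> I" for j
    using that \<open>I \<noteq> {}\<close> by (intro cINF_greatest) auto
  then have "(INF i\<in>I. g i (x + y)) - (INF i\<in>I. g i x) \<le> (INF j\<in>I. g j y)"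
    using \<open>I \<noteq> {}\<close> by (intro cINF_greatest) (auto simp: algebra_simps)
  then show "(INF i\<in>I. g i (x + y)) \<le> (INF i\<in>I. g i x) + (INF i\<in>I. g i y)"
    by simp
next
  fix r :: real and x
  assume "0 < r"
  have "(INF i\<in>I. g i (r *\<^sub>R x)) / r \<le> g i x" if "i \<in> I" for i
    using scale[OF \<open>0 < r\<close> that, of x] cINF_lower[OF bdd, of _ "r *\<^sub>R x"] \<open>0 < r\<close>
    by (fastforce simp: field_simps)
  then have "(INF i\<in>I. g i (r *\<^sub>R x)) / r \<le> (INF i\<in>I. g i x)"
    using \<open>I \<noteq> {}\<close> by (intro cINF_greatest) auto
  then show "(INF i\<in>I. g i (r *\<^sub>R x)) \<le> r * (INF i\<in>I. g i x)"
    using \<open>0 < r\<close> by (simp add: field_simps)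
next
  show "(INF i\<in>I. g i 0) = 0"
    using zero \<open>I \<noteq> {}\<close> by simp
qed

text \<open>The witness is the infimum over \<open>t >= 0\<close> of
  \<open>p (x + t *\<^sub>R w) - t * p w\<close>; the two bounds are its terms at
  \<open>t = 0\<close> and \<open>t = 1\<close>. At \<open>x = - w\<close> the second bound gives
  \<open>q (- w) <= - p w\<close>, so \<open>q\<close> is linear along \<open>w\<close>.\<close>

lemma sublinear_shift:
  assumes p: "sublinear p"
  obtains q where "sublinear q" "\<And>x. q x \<le> p x" "\<And>x. q x \<le> p (x + w) - p w"
proof -
  define g where "g = (\<lambda>t x. p (x + t *\<^sub>R w) - t * p w)"
  have bdd: "bdd_below ((\<lambda>t. g t x) ` {0..})" for x
  proof (rule bdd_belowI2)
    fix t :: real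
    assume "t \<in> {0..}"
    \<comment> \<open>Splitting \<open>t *\<^sub>R w\<close> into \<open>x + t *\<^sub>R w\<close>
      and \<open>- x\<close> bounds \<open>t * p w\<close> from above.\<close>
    then show "- p (- x) \<le> g t x"
      using sublinear_add[OF p, of "x + t *\<^sub>R w" "- x"] sublinear_scale[OF p, of t w]
      by (simp add: g_def)
  qed
  have "sublinear (\<lambda>x. INF t\<in>{0..}. g t x)"
  proof (rule sublinear_INF[OF bdd])
    fix s t :: real and x y
    assume "s \<in> {0..}" "t \<in> {0..}"
    then show "\<exists>k\<in>{0..}. g k (x + y) \<le> g s x + g t y"
      using sublinear_add[OF p, of "x + s *\<^sub>R w" "y + t *\<^sub>R w"]
      by (intro bexI[of _ "s + t"]) (auto simp: g_def algebra_simps)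
  next
    fix r t :: real and x
    assume "0 < r" "t \<in> {0..}"
    then show "\<exists>k\<in>{0..}. g k (r *\<^sub>R x) \<le> r * g t x"
      using sublinear_scale[OF p, of r "x + t *\<^sub>R w"]
      by (intro bexI[of _ "r * t"]) (auto simp: g_def algebra_simps)
  qed (auto simp: g_def sublinear_scale[OF p])
  moreover have "(INF t\<in>{0..}. g t x) \<le> p x" for x
    using cINF_lower[OF bdd, of 0 x] by (simp add: g_def)
  moreover have "(INF t\<in>{0..}. g t x) \<le> p (x + w) - p w" for x
    using cINF_lower[OF bdd, of 1 x] by (simp add: g_def)
  ultimately show thesis by (rule that)
qed

text \<open>Zorn's lemma yields maximal elements, so the order is reversed. A chain is bounded by
  its pointwise infimum, which is finite because each member is at least \<open>- p (- x)\<close> at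
  \<open>x\<close>.\<close>

lemma minimal_sublinear_exists:
  assumes p: "sublinear p"
  obtains m where "sublinear m" "m \<le> p" "\<And>q. sublinear q \<Longrightarrow> q \<le> m \<Longrightarrow> q = m"
proof -
  define A where "A = {q. sublinear q \<and> q \<le> p}"
  have "\<exists>m\<in>A. \<forall>q\<in>A. q \<le> m \<longrightarrow> q = m"
  proof (rule predicate_Zorn)
    show "partial_order_on A (relation_of (\<lambda>q q'. q' \<le> q) A)"
      by (rule partial_order_on_relation_ofI) auto
  next
    fix C
    assume "C \<in> Chains (relation_of (\<lambda>q q'. q' \<le> q) A)"
    then have total: "q \<le> q' \<or> q' \<le> q" and sub: "q \<in> A" if "q \<in> C" "q' \<in> C" for q q'
      using that by (auto simp: Chains_def relation_of_def)
    show "\<exists>u\<in>A. \<forall>q\<in>C. u \<le> q"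
    proof (cases "C = {}")
      \<comment> \<open>An infimum over the empty chain carries no information, so \<open>p\<close>
        itself is the bound.\<close>
      case True
      with p show ?thesis by (auto simp: A_def)
    next
      case False
      have C: "sublinear q" "q x \<le> p x" if "q \<in> C" for q x
        using sub[OF that that] by (auto simp: A_def le_fun_def)
      have bdd: "bdd_below ((\<lambda>q. q x) ` C)" for x
      proof (rule bdd_belowI2)
        show "- p (- x) \<le> q x" if "q \<in> C" for q
          using sublinear_ge_minus[OF C(1)[OF that], of x] C(2)[OF that, of "- x"] by simp
      qed
      have "sublinear (\<lambda>x. INF q\<in>C. q x)"
      proof (rule sublinear_INF[OF bdd])
        fix q q' x y
        assume q: "q \<in> C" "q' \<in> C"
        \<comment> \<open>The smaller of \<open>q\<close> and \<open>q'\<close> serves for both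
          summands, and it is subadditive.\<close>
        from total[OF q] show "\<exists>k\<in>C. k (x + y) \<le> q x + q' y"
        proof
          assume "q \<le> q'"
          then have "q y \<le> q' y" by (rule le_funD)
          then show ?thesis
            using q sublinear_add[OF C(1)[OF q(1)], of x y] by (intro bexI[of _ q]) auto
        next
          assume "q' \<le> q"
          then have "q' x \<le> q x" by (rule le_funD)
          then show ?thesis
            using q sublinear_add[OF C(1)[OF q(2)], of x y] by (intro bexI[of _ q']) auto
        qed
      next
        show "\<exists>k\<in>C. k (r *\<^sub>R x) \<le> r * q x" if "0 < r" "q \<in> C" for r q x
          using that sublinear_scale[OF C(1)] by (intro bexI[of _ q]) auto
      qed (use False in \<open>auto intro: sublinear_0 C\<close>)
      moreover have lower: "(INF q\<in>C. q x) \<le> q x" if "q \<in> C" for q x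
        using bdd that by (rule cINF_lower)
      moreover have "(INF q\<in>C. q x) \<le> p x" for x
        using False lower C(2) by (meson ex_in_conv order_trans)
      ultimately show ?thesis
        by (intro bexI[of _ "\<lambda>x. INF q\<in>C. q x"]) (auto simp: A_def le_fun_def)
    qed
  qed
  then obtain m where "m \<in> A" and "\<And>q. q \<in> A \<Longrightarrow> q \<le> m \<Longrightarrow> q = m" by blast
  moreover from this have "q = m" if "sublinear q" "q \<le> m" for q
    using that order_trans[of q m p] by (auto simp: A_def)
  ultimately show thesis using that by (auto simp: A_def)
qed

text \<open>The shift of \<open>m\<close> along \<open>w\<close> lies below \<open>m\<close> and
  hence equals \<open>m\<close>. Its second bound then reads \<open>m x <= m (x + w) - m w\<close>,
  the missing half of additivity.\<close>

lemma minimal_sublinear_linear: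
  assumes m: "sublinear m" and min: "\<And>q. sublinear q \<Longrightarrow> q \<le> m \<Longrightarrow> q = m"
  shows "linear m"
proof -
  have add: "m (x + w) = m x + m w" for x w
  proof -
    obtain q where "sublinear q" "q \<le> m" and q: "q x \<le> m (x + w) - m w"
      using sublinear_shift[OF m, of w] by (metis le_fun_def)
    then have "q = m" by (intro min)
    with q sublinear_add[OF m, of x w] show ?thesis by simp
  qed
  have minus: "m (- x) = - m x" for x
    using add[of x "- x"] sublinear_0[OF m] by simp
  have "m (r *\<^sub>R x) = r * m x" for r x
  proof (cases "0 \<le> r")
    case False
    then have "m ((- r) *\<^sub>R x) = (- r) * m x"
      by (intro sublinear_scale[OF m]) simp
    then show ?thesis using minus[of "r *\<^sub>R x"] by simp
  qed (rule sublinear_scale[OF m])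
  with add show ?thesis by (intro linearI) auto
qed

text \<open>A minimal functional below \<open>p\<close> need not agree with \<open>p\<close> at
  \<open>z\<close>, so the shift along \<open>z\<close> comes first: every linear \<open>f\<close>
  below \<open>q\<close> satisfies \<open>f (- z) <= - p z\<close>, that is,
  \<open>p z <= f z\<close>.\<close>

theorem sublinear_support:
  assumes p: "sublinear p"
  obtains f where "linear f" "\<And>x. f x \<le> p x" "f z = p z"
proof -
  obtain q where q: "sublinear q" "\<And>x. q x \<le> p x" "\<And>x. q x \<le> p (x + z) - p z"
    using sublinear_shift[OF p, of z] by blast
  obtain f where f: "sublinear f" "f \<le> q" and min: "\<And>g. sublinear g \<Longrightarrow> g \<le> f \<Longrightarrow> g = f"
    using minimal_sublinear_exists[OF q(1)] by blast
  have lin: "linear f"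
    using f(1) min by (rule minimal_sublinear_linear)
  have le: "f x \<le> q x" for x
    using f(2) by (rule le_funD)
  have "f (- z) \<le> - p z"
    using le[of "- z"] q(3)[of "- z"] sublinear_0[OF p] by simp
  then have "p z \<le> f z"
    using linear_neg[OF lin, of z] by simp
  moreover have le': "f x \<le> p x" for x
    using le[of x] q(2)[of x] by simp
  ultimately show thesis
    using that[OF lin le'] le'[of z] by simp
qed

lemma sublinear_norm: "sublinear (norm :: 'a::real_normed_vector \<Rightarrow> real)"
  by (simp add: sublinear_def norm_triangle_ineq)

section \<open>Norming functionals\<close>

lemma bounded_linear_onorm_eq_1:
  assumes "linear f" and le: "\<And>x. norm (f x) \<le> norm x" and "norm (f z) = norm z" "z \<noteq> 0"
  shows "bounded_linear f" "onorm f = 1"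
proof -
  show bl: "bounded_linear f"
    using assms(1) le by (auto simp: bounded_linear_def bounded_linear_axioms_def intro: exI[of _ 1])
  have "onorm f \<le> 1"
    using le by (intro onorm_bound) auto
  moreover have "1 \<le> onorm f"
    using onorm[OF bl, of z] assms(3,4) by simp
  ultimately show "onorm f = 1" by simp
qed

lemma norming_functional_real:
  fixes z :: "'a::real_normed_vector"
  assumes "z \<noteq> 0"
  shows "\<exists>f \<in> dual_sphere ((*\<^sub>R) :: real \<Rightarrow> 'a \<Rightarrow> 'a). f z = of_real (norm z)"
proof -
  obtain f :: "'a \<Rightarrow> real" where f: "linear f" "\<And>x. f x \<le> norm x" "f z = norm z"
    using sublinear_support[OF sublinear_norm] by blast
  have "norm (f x) \<le> norm x" for x
    using f(2)[of x] f(2)[of "- x"] linear_neg[OF f(1), of x] by simp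
  then have "bounded_linear f" "onorm f = 1"
    using bounded_linear_onorm_eq_1[OF f(1) _ _ assms] f(3) by auto
  moreover have "Vector_Spaces.linear (*\<^sub>R) (*) f"
    using f(1) unfolding linear_def real_scaleR_def[abs_def] .
  ultimately show ?thesis
    using f(3) by (auto simp: dual_sphere_def)
qed

text \<open>A complex functional is recovered from its real part \<open>u\<close> as
  \<open>u x - i * u (i x)\<close>, so a real norming functional can be complexified.\<close>

lemma norming_functional_complex:
  fixes smul :: "complex \<Rightarrow> 'a::real_normed_vector \<Rightarrow> 'a"
  assumes "normed_space_over smul" "z \<noteq> 0"
  shows "\<exists>f \<in> dual_sphere smul. f z = of_real (norm z)"
proof -
  interpret normed_space_over smul by fact
  obtain u :: "'a \<Rightarrow> real" where u: "linear u" "\<And>x. u x \<le> norm x" "u z = norm z"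
    using sublinear_support[OF sublinear_norm] by blast
  define f where "f x = Complex (u x) (- u (smul \<i> x))" for x
  have smul_expand: "smul c x = Re c *\<^sub>R x + Im c *\<^sub>R smul \<i> x" for c x
  proof -
    have "smul c x = smul (of_real (Re c) + of_real (Im c) * \<i>) x"
      by (simp add: complex_eq mult.commute)
    also have "\<dots> = Re c *\<^sub>R x + Im c *\<^sub>R smul \<i> x"
      by (simp only: scale_left_distrib scale_scale[symmetric] smul_of_real)
    finally show ?thesis .
  qed
  have f_add: "f (x + y) = f x + f y" for x y
    by (simp add: f_def complex_eq_iff scale_right_distrib linear_add[OF u(1)])
  have u_smul: "u (smul c x) = Re c * u x + Im c * u (smul \<i> x)" for c x
    by (simp add: smul_expand[of c x] linear_add[OF u(1)] linear_cmul[OF u(1)])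
  \<comment> \<open>The two instances of \<open>u_smul\<close> give the real and the imaginary
    part.\<close>
  have f_smul: "f (smul c x) = c * f x" for c x
    using u_smul[of c x] u_smul[of "\<i> * c" x] by (simp add: f_def complex_eq_iff)
  have lin: "linear f"
    using f_smul[of "of_real _"]
    by (intro linearI f_add) (simp add: smul_of_real scaleR_conv_of_real)
  have le: "norm (f x) \<le> norm x" for x
  proof -
    \<comment> \<open>Rotating \<open>x\<close> makes \<open>f\<close> real and non-negative there, so that \<open>f\<close> and \<open>u\<close> agree.\<close>
    obtain c where c: "norm c = 1" "c * f x = of_real (norm (f x))"
    proof (cases "f x = 0")
      case False
      then show thesis
        by (intro that[of "cnj (f x) / norm (f x)"])
          (auto simp: norm_divide complex_norm_square[symmetric] mult.commute[of "cnj _"]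
            power2_eq_square)
    qed (use that[of 1] in auto)
    have "norm (f x) = Re (f (smul c x))"
      by (simp add: f_smul c)
    also have "\<dots> \<le> norm x"
      using u(2)[of "smul c x"] by (simp add: f_def norm_smul c)
    finally show ?thesis .
  qed
  \<comment> \<open>The real part of \<open>f z\<close> is already \<open>norm z\<close>, so the
    bound on the modulus leaves no room for an imaginary part.\<close>
  have fz: "f z = of_real (norm z)"
  proof -
    have "(Re (f z))\<^sup>2 + (Im (f z))\<^sup>2 \<le> (norm z)\<^sup>2"
      using power_mono[OF le[of z], of 2] by (simp add: cmod_power2)
    then show ?thesis
      by (simp add: f_def u(3) complex_eq_iff)
  qed
  have "bounded_linear f" "onorm f = 1"
    using bounded_linear_onorm_eq_1[OF lin le _ assms(2)] fz by auto
  moreover have "Vector_Spaces.linear smul (*) f"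
    by unfold_locales (simp_all add: f_add f_smul algebra_simps)
  ultimately show ?thesis
    using fz by (auto simp: dual_sphere_def)
qed

section \<open>Nonsquareness\<close>

lemma dual_sphere_add: "f \<in> dual_sphere smul \<Longrightarrow> f (x + y) = f x + f y"
  and dual_sphere_minus: "f \<in> dual_sphere smul \<Longrightarrow> f (- x) = - f x"
  by (auto simp: dual_sphere_def bounded_linear.linear linear_add linear_neg)

lemma dual_sphere_norm_le: "f \<in> dual_sphere smul \<Longrightarrow> norm (f x) \<le> norm x"
  using onorm[of f x] by (simp add: dual_sphere_def)

text \<open>The unit ball of the scalars is uniformly convex: by the parallelogram law
  \<open>|a - b|^2 <= 4 - |a + b|^2\<close>, which tends to 0. The class \<open>real_inner\<close>
  gives this law for real and complex scalars at once.\<close>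

lemma tendsto_1_if_sum_tendsto_2:
  fixes a b :: "nat \<Rightarrow> 'k::{real_normed_field, real_inner}"
  assumes a: "\<And>n. norm (a n) \<le> 1" and b: "\<And>n. norm (b n) \<le> 1"
    and sum: "(\<lambda>n. a n + b n) \<longlonglongrightarrow> 2"
  shows "a \<longlonglongrightarrow> 1"
proof -
  have "(\<lambda>n. (norm (a n - b n))\<^sup>2) \<longlonglongrightarrow> 0"
  proof (rule tendsto_sandwich[OF _ _ tendsto_const])
    show "\<forall>\<^sub>F n in sequentially. (norm (a n - b n))\<^sup>2 \<le> 4 - (norm (a n + b n))\<^sup>2"
    proof (intro always_eventually allI)
      fix n
      have "(norm (a n))\<^sup>2 \<le> 1" "(norm (b n))\<^sup>2 \<le> 1"
        using a b by (simp_all add: power_le_one)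
      moreover have "(norm (a n + b n))\<^sup>2 + (norm (a n - b n))\<^sup>2 = 2 * (norm (a n))\<^sup>2 + 2 * (norm (b n))\<^sup>2"
        by (simp add: power2_norm_eq_inner algebra_simps inner_commute)
      ultimately show "(norm (a n - b n))\<^sup>2 \<le> 4 - (norm (a n + b n))\<^sup>2" by linarith
    qed
    show "(\<lambda>n. 4 - (norm (a n + b n))\<^sup>2) \<longlonglongrightarrow> 0"
      by (rule tendsto_eq_intros sum refl | simp)+
  qed simp
  then have "(\<lambda>n. sqrt ((norm (a n - b n))\<^sup>2)) \<longlonglongrightarrow> sqrt 0"
    by (rule tendsto_real_sqrt)
  then have "(\<lambda>n. a n - b n) \<longlonglongrightarrow> 0"
    by (simp add: tendsto_norm_zero_iff)
  then have "(\<lambda>n. ((a n + b n) + (a n - b n)) / 2) \<longlonglongrightarrow> (2 + 0) / 2"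
    by (intro tendsto_intros sum) auto
  then show ?thesis by simp
qed

text \<open>With norming functionals as the hypothesis \<open>norming\<close>, one argument serves
  both scalar fields.\<close>

lemma sluacs_imp_lunsq:
  fixes smul :: "'k::{real_normed_field, real_inner} \<Rightarrow> 'a::real_normed_vector \<Rightarrow> 'a"
  assumes norming: "\<And>z. z \<noteq> 0 \<Longrightarrow> \<exists>f \<in> dual_sphere smul. f z = of_real (norm z)"
    and sluacs: "sluacs smul"
  shows "lunsq TYPE('a)"
proof (rule ccontr)
  assume "\<not> lunsq TYPE('a)"
  then obtain x :: 'a where x: "norm x = 1"
    and sq: "\<And>\<delta>. \<delta> > 0 \<Longrightarrow> \<exists>y. norm y = 1 \<and> 2 - \<delta> < min (norm (x + y)) (norm (x - y))"
    by (auto simp: lunsq_def not_le Bex_def)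
  have "\<forall>n. \<exists>y. norm y = 1 \<and> 2 - inverse (real (Suc n)) < min (norm (x + y)) (norm (x - y))"
    by (intro allI sq) simp
  then obtain y where y: "\<And>n. norm (y n) = 1"
    and ylow: "\<And>n. 2 - inverse (real (Suc n)) < min (norm (x + y n)) (norm (x - y n))"
    by metis
  \<comment> \<open>The lower bound \<open>2 - 1 / (n + 1)\<close> is at least 1 already for
    \<open>n = 0\<close>.\<close>
  have "x + y n \<noteq> 0" for n
    using ylow[of n] inverse_le_1_iff[of "real (Suc n)"] by auto
  then have "\<forall>n. \<exists>f. f \<in> dual_sphere smul \<and> f (x + y n) = of_real (norm (x + y n))"
    using norming by blast
  then obtain f where f: "\<And>n. f n \<in> dual_sphere smul"
    and fxy: "\<And>n. f n (x + y n) = of_real (norm (x + y n))"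
    by metis
  have lim: "(\<lambda>n. 2 - inverse (real (Suc n))) \<longlonglongrightarrow> 2"
    using tendsto_diff[OF tendsto_const LIMSEQ_inverse_real_of_nat, of "2::real"] by simp
  have plus: "(\<lambda>n. norm (x + y n)) \<longlonglongrightarrow> 2"
  proof (rule tendsto_sandwich[OF _ _ lim tendsto_const])
    show "\<forall>\<^sub>F n in sequentially. 2 - inverse (real (Suc n)) \<le> norm (x + y n)"
      using ylow by (intro always_eventually allI) (simp add: less_imp_le)
    show "\<forall>\<^sub>F n in sequentially. norm (x + y n) \<le> 2"
      using norm_triangle_ineq[of x "y _"] by (intro always_eventually allI) (simp add: x y)
  qed
  have minus: "(\<lambda>n. norm (x - y n)) \<longlonglongrightarrow> 2"
  proof (rule tendsto_sandwich[OF _ _ lim tendsto_const])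
    show "\<forall>\<^sub>F n in sequentially. 2 - inverse (real (Suc n)) \<le> norm (x - y n)"
      using ylow by (intro always_eventually allI) (simp add: less_imp_le)
    show "\<forall>\<^sub>F n in sequentially. norm (x - y n) \<le> 2"
      using norm_triangle_ineq4[of x "y _"] by (intro always_eventually allI) (simp add: x y)
  qed
  have sum: "(\<lambda>n. f n x + f n (y n)) \<longlonglongrightarrow> 2"
    using tendsto_of_real[OF plus, where 'a = 'k] by (simp add: fxy[symmetric] dual_sphere_add[OF f])
  have norms: "norm (f n x) \<le> 1" "norm (f n (y n)) \<le> 1" for n
    using dual_sphere_norm_le[OF f, of n] x y by metis+
  have fx: "(\<lambda>n. f n x) \<longlonglongrightarrow> 1"
    using norms sum by (rule tendsto_1_if_sum_tendsto_2)
  have fy: "(\<lambda>n. f n (y n)) \<longlonglongrightarrow> 1"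
    using norms(2,1) sum[unfolded add.commute[of "f _ x"]] by (rule tendsto_1_if_sum_tendsto_2)
  \<comment> \<open>The base point in \<open>sluacs\<close> is a fixed vector, so \<open>- x\<close>
    takes this role and \<open>y\<close> is the sequence on which \<open>f\<close> tends to
    1.\<close>
  have "(\<lambda>n. norm (y n + - x)) \<longlonglongrightarrow> 2"
    using minus by (simp add: norm_minus_commute)
  then have "(\<lambda>n. f n (- x)) \<longlonglongrightarrow> 1"
    using sluacs[unfolded sluacs_def, rule_format, of "- x" y f] x y f fy by simp
  then have "(\<lambda>n. f n x) \<longlonglongrightarrow> - 1"
    using tendsto_minus by (fastforce simp: dual_sphere_minus[OF f])
  with fx have "(1::'k) = - 1" by (rule LIMSEQ_unique)
  then show False by simp
qed

lemma acs_imp_nsq: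
  fixes smul :: "'k::{real_normed_field, real_inner} \<Rightarrow> 'a::real_normed_vector \<Rightarrow> 'a"
  assumes norming: "\<And>z. z \<noteq> 0 \<Longrightarrow> \<exists>f \<in> dual_sphere smul. f z = of_real (norm z)"
    and acs: "acs smul"
  shows "nsq TYPE('a)"
proof (rule ccontr)
  assume "\<not> nsq TYPE('a)"
  then obtain x y :: 'a where x: "norm x = 1" and y: "norm y = 1"
    and "2 \<le> norm (x + y)" "2 \<le> norm (x - y)"
    by (auto simp: nsq_def not_less)
  with norm_triangle_ineq[of x y] norm_triangle_ineq4[of x y]
  have plus: "norm (x + y) = 2" and minus: "norm (x - y) = 2" by auto
  then have "x + y \<noteq> 0" by auto
  then obtain f where f: "f \<in> dual_sphere smul" and fxy: "f (x + y) = of_real (norm (x + y))"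
    using norming by blast
  have sum: "f x + f y = 2"
    using fxy plus by (simp add: dual_sphere_add[OF f])
  have norms: "norm (f x) \<le> 1" "norm (f y) \<le> 1"
    using dual_sphere_norm_le[OF f] x y by metis+
  \<comment> \<open>For constant sequences the limit lemma says that two scalars of modulus at most
    1 with sum 2 are both 1.\<close>
  have "(\<lambda>n::nat. f x) \<longlonglongrightarrow> 1"
    by (rule tendsto_1_if_sum_tendsto_2[of _ "\<lambda>n. f y"]) (simp_all add: norms sum)
  then have "f x = 1" by (simp add: LIMSEQ_const_iff)
  with sum have "f y = 1" by simp
  \<comment> \<open>Here the pair is \<open>x\<close>, \<open>- y\<close>; without limits the
    situation is symmetric in \<open>x\<close> and \<open>y\<close>.\<close>
  moreover have "f (- y) = 1"
    using acs[unfolded acs_def, rule_format, of x "- y" f] x y f minus \<open>f x = 1\<close> by simp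
  ultimately show False
    by (simp add: dual_sphere_minus[OF f])
qed

theorem proposition3p8:
  fixes scaleC :: "complex \<Rightarrow> 'c::banach \<Rightarrow> 'c"
  shows
    "((sluacs ((*\<^sub>R) :: real \<Rightarrow> 'r::banach \<Rightarrow> 'r) \<longrightarrow> lunsq TYPE('r)) \<and>
      (acs ((*\<^sub>R) :: real \<Rightarrow> 'r \<Rightarrow> 'r) \<longrightarrow> nsq TYPE('r))) \<and>
     (normed_space_over scaleC \<longrightarrow>
       (sluacs scaleC \<longrightarrow> lunsq TYPE('c)) \<and> (acs scaleC \<longrightarrow> nsq TYPE('c)))"
  by (intro conjI impI)
    (rule sluacs_imp_lunsq acs_imp_nsq, erule norming_functional_real norming_functional_complex,
      assumption+)+

end
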